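(* Let $t,k\ge 2$ be given integers. Then ${\rm forb}(m,\{t\cdot I_k,\,t\cdot I_k^c,\,t\cdot T_k\})$ is $\Theta(m)$ as $m\to\infty$.
   Context: A matrix is simple if it is a (0,1)-matrix with no repeated columns. For (0,1)-matrices $F$ and $A$, $F\prec A$ means some row and column permutation of $F$ is a submatrix of $A$. For a finite family $\mathcal F$ of (0,1)-matrices, ${\rm forb}(m,\mathcal F)$ is the maximum number of columns of an $m$-rowed simple matrix $A$ with $F\not\prec A$ for every $F\in\mathcal F$. $t\cdot M$ denotes the concatenation of $t$ copies of $M$. $I_k$ is the $k\times k$ identity matrix, $I_k^c$ its (0,1)-complement, and $T_k$ is the $k\times k$ (0,1)-matrix whose $(i,j)$ entry is 1 if and only if $i\le j$. *)

theory Defs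
  imports
    "Jordan_Normal_Form.DL_Submatrix"
    "HOL-Combinatorics.Permutations"
    "HOL-Library.Landau_Symbols"
begin

definition zero_one_mat :: "int mat \<Rightarrow> bool" where
  "zero_one_mat A \<longleftrightarrow> elements_mat A \<subseteq> {0, 1}"

definition simple_mat :: "int mat \<Rightarrow> bool" where
  "simple_mat A \<longleftrightarrow> zero_one_mat A \<and> distinct (cols A)"

definition permute_mat :: "(nat \<Rightarrow> nat) \<Rightarrow> (nat \<Rightarrow> nat) \<Rightarrow> int mat \<Rightarrow> int mat" where
  "permute_mat p q F = mat (dim_row F) (dim_col F) (\<lambda>(i, j). F $$ (p i, q j))"

definition configuration :: "int mat \<Rightarrow> int mat \<Rightarrow> bool" (infix "\<prec>\<^sub>c" 50) where
  "F \<prec>\<^sub>c A \<longleftrightarrow> (\<exists>p q I J. p permutes {..<dim_row F} \<and> q permutes {..<dim_col F} \<and>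
      I \<subseteq> {..<dim_row A} \<and> J \<subseteq> {..<dim_col A} \<and>
      permute_mat p q F = submatrix A I J)"

text \<open>An \<open>m\<close>-rowed simple matrix has at most \<open>2 ^ m\<close> columns, so the set below is finite.
  It contains \<open>0\<close> as soon as every member of the family has at least one column; otherwise
  it may be empty and \<open>Max\<close> unspecified.\<close>

definition forb :: "nat \<Rightarrow> int mat set \<Rightarrow> nat" where
  "forb m \<F> = Max {dim_col A | A. dim_row A = m \<and> simple_mat A \<and> (\<forall>F\<in>\<F>. \<not> F \<prec>\<^sub>c A)}"

definition copies :: "nat \<Rightarrow> int mat \<Rightarrow> int mat" where
  "copies t M = mat (dim_row M) (t * dim_col M) (\<lambda>(i, j). M $$ (i, j mod dim_col M))"

definition compl_mat :: "int mat \<Rightarrow> int mat" where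
  "compl_mat A = map_mat (\<lambda>x. 1 - x) A"

definition tower_mat :: "nat \<Rightarrow> int mat" where
  "tower_mat k = mat k k (\<lambda>(i, j). if i \<le> j then 1 else 0)"

end

theory Submission
  imports Defs "HOL-Library.Ramsey"
begin

text \<open>
  Lower bound: every row of the identity matrix contains a single 1, whereas each forbidden matrix
  has a row with two 1s.

  Upper bound: allow repeated columns, but each at most \<open>t - 1\<close> times, and induct on the number of
  rows. After deleting a row, the distinct columns of multiplicity at least \<open>t\<close> form a matrix
  that avoids \<open>I\<^sub>k\<close>, \<open>I\<^sub>k\<^sup>c\<close> and \<open>T\<^sub>k\<close>, for otherwise \<open>t\<close> copies of one of these would occur. By
  the theorem of Balogh and Bollobas the number of such columns is bounded by a constant, so
  discarding constantly many columns restores the multiplicity bound. The Balogh-Bollobas theorem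
  itself follows from Ramsey's theorem for graphs: repeatedly splitting the set of columns along a
  row and continuing with the larger part produces a large square submatrix in which each row
  is constant to the right of the diagonal and takes the opposite value on the diagonal.
\<close>

text \<open>Arrays are Boolean functions with explicit index sets, so deleting rows or columns needs
  no reindexing. The injections \<open>r\<close> and \<open>c\<close> need not be monotone and thus
  absorb permutations; \<open>j mod k\<close> lays \<open>t\<close> copies of \<open>M\<close> side
  by side.\<close>

definition occurs :: "nat \<Rightarrow> nat \<Rightarrow> (nat \<Rightarrow> nat \<Rightarrow> bool) \<Rightarrow> ('r \<Rightarrow> 'c \<Rightarrow> bool) \<Rightarrow> 'r set \<Rightarrow> 'c set \<Rightarrow> bool"
  where "occurs t k M a R J \<longleftrightarrow> (\<exists>r c. inj_on r {..<k} \<and> r ` {..<k} \<subseteq> R \<and>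
    inj_on c {..<t * k} \<and> c ` {..<t * k} \<subseteq> J \<and> (\<forall>i<k. \<forall>j<t * k. a (r i) (c j) \<longleftrightarrow> M i (j mod k)))"

lemma occurs_mono:
  "occurs t k M a R J \<Longrightarrow> R \<subseteq> R' \<Longrightarrow> J \<subseteq> J' \<Longrightarrow> occurs t k M a R' J'"
  unfolding occurs_def by (meson order_trans)

lemma occurs_1I:
  assumes "inj_on r {..<k}" "r ` {..<k} \<subseteq> R" "inj_on c {..<k}" "c ` {..<k} \<subseteq> J"
    and "\<And>i j. i < k \<Longrightarrow> j < k \<Longrightarrow> a (r i) (c j) \<longleftrightarrow> M i j"
  shows "occurs 1 k M a R J"
  unfolding occurs_def using assms by (intro exI[of _ r] exI[of _ c]) auto

section \<open>The Balogh-Bollobas theorem\<close>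

text \<open>Distinct columns differ in some row. Split along it, keep the larger half for the later
  columns and pick one column of the other half; \<open>b i\<close> is the value of row
  \<open>r i\<close> on the kept half. Each split at most halves the columns, hence
  \<open>2 ^ n\<close>.\<close>

lemma splitting_sequence:
  assumes "finite J" "inj_on (\<lambda>j. {i \<in> R. a i j}) J" "2 ^ n \<le> card J"
  shows "\<exists>r c b. (\<forall>i<n. r i \<in> R \<and> c i \<in> J \<and> a (r i) (c i) = (\<not> b i)) \<and>
    (\<forall>i j. i < j \<longrightarrow> j < n \<longrightarrow> a (r i) (c j) = b i)"
  using assms
proof (induction n arbitrary: J)
  case 0
  then show ?case by simp
next
  case (Suc n)
  have "1 < card J"
    using Suc.prems(3) one_less_power[of "2::nat" "Suc n"] by linarith
  then obtain x y where xy: "x \<in> J" "y \<in> J" "x \<noteq> y"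
    by (metis card_le_Suc0_iff_eq Suc.prems(1) One_nat_def not_less)
  then have "{i \<in> R. a i x} \<noteq> {i \<in> R. a i y}"
    using Suc.prems(2) by (auto dest: inj_onD)
  then obtain \<rho> where \<rho>: "\<rho> \<in> R" "a \<rho> x \<noteq> a \<rho> y" by auto
  define half where "half = (\<lambda>\<beta>. {j \<in> J. a \<rho> j = \<beta>})"
  have "J = half True \<union> half False" "half True \<inter> half False = {}"
    by (auto simp: half_def)
  then have "card J = card (half True) + card (half False)"
    using Suc.prems(1) by (metis card_Un_disjoint finite_Un)
  then have "2 ^ n \<le> card (half True) \<or> 2 ^ n \<le> card (half False)"
    using Suc.prems(3) by auto
  then obtain \<beta> where \<beta>: "2 ^ n \<le> card (half \<beta>)" by blast
  \<comment> \<open>Both halves are nonempty, as \<open>x\<close> and \<open>y\<close> differ in row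
    \<open>\<rho>\<close>.\<close>
  obtain z where z: "z \<in> J" "a \<rho> z = (\<not> \<beta>)" using xy \<rho> by blast
  have sub: "half \<beta> \<subseteq> J" by (auto simp: half_def)
  obtain r c b where rcb: "\<forall>i<n. r i \<in> R \<and> c i \<in> half \<beta> \<and> a (r i) (c i) = (\<not> b i)"
    "\<forall>i j. i < j \<longrightarrow> j < n \<longrightarrow> a (r i) (c j) = b i"
    using Suc.IH[OF finite_subset[OF sub Suc.prems(1)] inj_on_subset[OF Suc.prems(2) sub] \<beta>]
    by blast
  \<comment> \<open>The new row, column and value are put in front, at index 0.\<close>
  let ?r = "case_nat \<rho> r" and ?c = "case_nat z c" and ?b = "case_nat \<beta> b"
  have "?r i \<in> R \<and> ?c i \<in> J \<and> a (?r i) (?c i) = (\<not> ?b i)" if "i < Suc n" for i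
    using that \<rho>(1) z rcb(1) sub by (cases i) auto
  moreover have "a (?r i) (?c j) = ?b i" if ij: "i < j" "j < Suc n" for i j
  proof -
    obtain j' where j': "j = Suc j'" "j' < n" using ij by (cases j) auto
    show ?thesis
    proof (cases i)
      case 0
      then show ?thesis using rcb(1) j' by (simp add: half_def)
    next
      case (Suc i')
      then show ?thesis using rcb(2) ij j' by simp
    qed
  qed
  ultimately show ?case by (intro exI[of _ ?r] exI[of _ ?c] exI[of _ ?b]) simp
qed

text \<open>If \<open>b = d\<close>, the array is an identity matrix or its complement; otherwise it
  is triangular and becomes \<le> after a shift or a reversal. The extra index pays for the
  shift.\<close>

lemma homogeneous_occurs:
  assumes mem: "\<And>i. i < Suc k \<Longrightarrow> r i \<in> R \<and> c i \<in> J"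
    and val: "\<And>i j. i < Suc k \<Longrightarrow> j < Suc k \<Longrightarrow>
      a (r i) (c j) = (if i = j then \<not> b else if i < j then b else d)"
  shows "\<exists>M\<in>{(=), (\<noteq>), (\<le>)}. occurs 1 k M a R J"
proof -
  \<comment> \<open>Rows \<open>r i\<close> and \<open>r j\<close> differ in column
    \<open>c j\<close>, and columns \<open>c i\<close> and \<open>c j\<close> differ in row
    \<open>r i\<close>, so injectivity comes for free.\<close>
  have r: "inj_on r {..<Suc k}"
  proof (rule linorder_inj_onI')
    fix i j assume "i \<in> {..<Suc k}" "j \<in> {..<Suc k}" "i < j"
    then show "r i \<noteq> r j" using val[of i j] val[of j j] by auto
  qed
  have c: "inj_on c {..<Suc k}"
  proof (rule linorder_inj_onI')
    fix i j assume "i \<in> {..<Suc k}" "j \<in> {..<Suc k}" "i < j"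
    then show "c i \<noteq> c j" using val[of i j] val[of i i] by auto
  qed
  have rk: "inj_on r {..<k}" "inj_on c {..<k}"
    by (rule inj_on_subset[OF r], simp add: lessThan_Suc subset_insertI)
      (rule inj_on_subset[OF c], simp add: lessThan_Suc subset_insertI)
  have "occurs 1 k (=) a R J" if "\<not> b" "\<not> d"
    by (rule occurs_1I[of r _ _ c]) (use rk mem in \<open>auto simp: val that\<close>)
  moreover have "occurs 1 k (\<noteq>) a R J" if "b" "d"
    by (rule occurs_1I[of r _ _ c]) (use rk mem in \<open>auto simp: val that\<close>)
  moreover have "occurs 1 k (\<le>) a R J" if "b" "\<not> d"
    \<comment> \<open>The 1s lie strictly above the diagonal, so the columns are shifted by one.\<close>
  proof (rule occurs_1I[of r _ _ "\<lambda>j. c (Suc j)"])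
    show "inj_on (\<lambda>j. c (Suc j)) {..<k}"
      using c by (auto simp: inj_on_def)
  qed (use rk mem in \<open>auto simp: val that\<close>)
  moreover have "occurs 1 k (\<le>) a R J" if "\<not> b" "d"
    \<comment> \<open>The 1s lie on and below the diagonal, so both orders are reversed.\<close>
  proof (rule occurs_1I[of "\<lambda>i. r (k - Suc i)" _ _ "\<lambda>j. c (k - Suc j)"])
    show "inj_on (\<lambda>i. r (k - Suc i)) {..<k}"
    proof (rule inj_onI)
      fix x y assume xy: "x \<in> {..<k}" "y \<in> {..<k}" "r (k - Suc x) = r (k - Suc y)"
      then have "k - Suc x = k - Suc y" by (intro inj_onD[OF rk(1)]) auto
      then show "x = y" using xy by simp
    qed
    show "inj_on (\<lambda>j. c (k - Suc j)) {..<k}"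
    proof (rule inj_onI)
      fix x y assume xy: "x \<in> {..<k}" "y \<in> {..<k}" "c (k - Suc x) = c (k - Suc y)"
      then have "k - Suc x = k - Suc y" by (intro inj_onD[OF rk(2)]) auto
      then show "x = y" using xy by simp
    qed
  qed (use mem in \<open>auto simp: val that\<close>)
  ultimately show ?thesis by (cases b; cases d) auto
qed

text \<open>Splitting fixes the entries on and to the right of the diagonal, pigeonhole makes them
  independent of the row, and Ramsey's theorem makes those below the diagonal constant. The bound
  \<open>B\<close> is uniform in \<open>a\<close>, \<open>R\<close> and \<open>J\<close>.\<close>

theorem Balogh_Bollobas:
  "\<exists>B. \<forall>(a :: 'r \<Rightarrow> 'c \<Rightarrow> bool) R J. finite J \<longrightarrow> inj_on (\<lambda>j. {i \<in> R. a i j}) J \<longrightarrow> B \<le> card J \<longrightarrow>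
    (\<exists>M\<in>{(=), (\<noteq>), (\<le>)}. occurs 1 k M a R J)"
proof -
  obtain N where N: "\<forall>(V :: nat set) E. finite V \<and> N \<le> card V \<longrightarrow>
      (\<exists>H\<subseteq>V. card H = Suc k \<and> clique H E \<or> card H = Suc k \<and> indep H E)"
    using ramsey2[of "Suc k" "Suc k"] by (elim exE conjE)
  have "\<exists>M\<in>{(=), (\<noteq>), (\<le>)}. occurs 1 k M a R J"
    if J: "finite J" "inj_on (\<lambda>j. {i \<in> R. a i j}) J" "2 ^ (2 * N) \<le> card J"
    for a :: "'r \<Rightarrow> 'c \<Rightarrow> bool" and R J
  proof -
    obtain r c b where mem: "\<forall>i<2 * N. r i \<in> R \<and> c i \<in> J \<and> a (r i) (c i) = (\<not> b i)"
      and right: "\<forall>i j. i < j \<longrightarrow> j < 2 * N \<longrightarrow> a (r i) (c j) = b i"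
      using splitting_sequence[OF J] by (elim exE conjE)
    \<comment> \<open>Of the \<open>2 * N\<close> rows, at least \<open>N\<close> share the same
      value \<open>b i\<close>.\<close>
    define half where "half = (\<lambda>\<beta>. {i. i < 2 * N \<and> b i = \<beta>})"
    have fin: "finite (half \<beta>)" for \<beta> by (simp add: half_def)
    have "card (half True \<union> half False) = card (half True) + card (half False)"
      using fin by (intro card_Un_disjoint) (auto simp: half_def)
    moreover have "half True \<union> half False = {..<2 * N}"
      by (auto simp: half_def)
    ultimately have "2 * N = card (half True) + card (half False)" by simp
    then have "N \<le> card (half True) \<or> N \<le> card (half False)" by linarith
    then obtain \<beta> where \<beta>: "N \<le> card (half \<beta>)" by blast
    \<comment> \<open>The graph records the entries below the diagonal, the only ones still
      free.\<close>
    define E where "E = {{i, j} | i j. i < j \<and> a (r j) (c i)}"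
    have E: "{i, j} \<in> E \<longleftrightarrow> a (r j) (c i)" if "i < j" for i j
      using that by (auto simp: E_def doubleton_eq_iff)
    obtain H where H: "H \<subseteq> half \<beta>" "card H = Suc k" "clique H E \<or> indep H E"
      using N[rule_format, OF conjI[OF fin \<beta>], of E] by (elim exE conjE disjE) simp_all
    \<comment> \<open>\<open>H\<close> contains the two vertices \<open>i\<close> and
      \<open>j\<close>, so it cannot be both a clique and independent; which one it is gives the
      common value.\<close>
    have d: "a (r j) (c i) = clique H E" if "i \<in> H" "j \<in> H" "i < j" for i j
      using H(3)
    proof
      assume "clique H E"
      then show ?thesis using E[OF that(3)] that by (simp add: clique_def)
    next
      assume indep: "indep H E"
      then have "{i, j} \<notin> E" using that by (simp add: indep_def)
      moreover from this have "\<not> clique H E" using that unfolding clique_def by (metis less_irrefl)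
      ultimately show ?thesis using E[OF that(3)] by simp
    qed
    have "finite H" using H(1) fin by (rule finite_subset)
    \<comment> \<open>An increasing enumeration preserves the sides of the diagonal.\<close>
    then obtain h where h: "strict_mono_on {..<Suc k} h" "\<forall>n<Suc k. h n \<in> H"
      using finite_enumerate[of H] H(2) by auto
    have hH: "h i < 2 * N \<and> b (h i) = \<beta>" if "i < Suc k" for i
      using h(2) H(1) that by (auto simp: half_def)
    have hmono: "h i < h j" if "i < j" "j < Suc k" for i j
      using h(1) that by (auto simp: strict_mono_on_def)
    show ?thesis
    proof (rule homogeneous_occurs[where r = "r \<circ> h" and c = "c \<circ> h" and b = \<beta> and d = "clique H E"])
      fix i j assume ij: "i < Suc k" "j < Suc k"
      consider "i = j" | "i < j" | "j < i" by linarith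
      then show "a ((r \<circ> h) i) ((c \<circ> h) j) = (if i = j then \<not> \<beta> else if i < j then \<beta> else clique H E)"
      proof cases
        case 1
        then show ?thesis using mem hH[OF ij(1)] by simp
      next
        case 2
        then show ?thesis using right hH[OF ij(1)] hH[OF ij(2)] hmono[OF 2 ij(2)] by simp
      next
        case 3
        then show ?thesis using d[of "h j" "h i"] h(2) ij hmono[OF 3 ij(1)] by simp
      qed
    qed (use mem hH in auto)
  qed
  then show ?thesis by (intro exI[of _ "2 ^ (2 * N)"] allI impI)
qed

section \<open>Bounded multiplicities\<close>

text \<open>Each column of the pattern found in \<open>K\<close> is replaced by \<open>t\<close>
  columns of \<open>J\<close> that agree with it on \<open>R\<close>. The classes of different
  columns of \<open>K\<close> are disjoint, so no column is used twice.\<close>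

lemma occurs_copies:
  assumes occ: "occurs 1 k M a R K" and "K \<subseteq> J"
    and inj: "inj_on (\<lambda>j. {i \<in> R. a i j}) K"
    and mult: "\<And>x. x \<in> K \<Longrightarrow> finite {j \<in> J. \<forall>i\<in>R. a i j = a i x} \<and> t \<le> card {j \<in> J. \<forall>i\<in>R. a i j = a i x}"
  shows "occurs t k M a R J"
proof -
  obtain r c where rc: "inj_on r {..<k}" "r ` {..<k} \<subseteq> R" "inj_on c {..<k}" "c ` {..<k} \<subseteq> K"
    and M: "\<forall>i<k. \<forall>j<k. a (r i) (c j) \<longleftrightarrow> M i j"
    using occ unfolding occurs_def by auto
  have "\<exists>g. inj_on g {..<t} \<and> g ` {..<t} \<subseteq> {j \<in> J. \<forall>i\<in>R. a i j = a i x}" if "x \<in> K" for x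
    using mult[OF that] card_le_inj[of "{..<t}"] by (auto simp: conj_commute)
  then have "\<forall>x\<in>K. \<exists>g. inj_on g {..<t} \<and> g ` {..<t} \<subseteq> {j \<in> J. \<forall>i\<in>R. a i j = a i x}" by blast
  from bchoice[OF this] obtain g where g: "\<And>x. x \<in> K \<Longrightarrow> inj_on (g x) {..<t}"
    "\<And>x u. x \<in> K \<Longrightarrow> u < t \<Longrightarrow> g x u \<in> J \<and> (\<forall>i\<in>R. a i (g x u) = a i x)"
    by (auto simp: image_subset_iff)
  have c: "c (j mod k) \<in> K" "j div k < t" "j mod k < k" if "j < t * k" for j
    using rc(4) that by (cases "k = 0"; force simp: less_mult_imp_div_less)+
  show ?thesis
    unfolding occurs_def
  \<comment> \<open>Column \<open>j\<close> is copy number \<open>j div k\<close> of pattern column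
    \<open>j mod k\<close>.\<close>
  proof (intro exI[of _ r] exI[of _ "\<lambda>j. g (c (j mod k)) (j div k)"] conjI allI impI)
    show "inj_on (\<lambda>j. g (c (j mod k)) (j div k)) {..<t * k}"
    proof (rule inj_onI)
      fix x y assume xy: "x \<in> {..<t * k}" "y \<in> {..<t * k}"
        and eq: "g (c (x mod k)) (x div k) = g (c (y mod k)) (y div k)"
      have cx: "c (x mod k) \<in> K" "x div k < t" and cy: "c (y mod k) \<in> K" "y div k < t"
        using c xy by auto
      have "\<forall>i\<in>R. a i (c (x mod k)) = a i (c (y mod k))"
        using g(2)[OF cx] g(2)[OF cy] eq by auto
      then have *: "c (x mod k) = c (y mod k)"
        by (intro inj_onD[OF inj _ cx(1) cy(1)]) auto
      then have "x mod k = y mod k"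
        using rc(3) c(3) xy by (auto dest: inj_onD)
      moreover have "x div k = y div k"
        using g(1)[OF cx(1)] eq cx(2) cy(2) unfolding * by (auto dest: inj_onD)
      ultimately show "x = y" by (metis div_mult_mod_eq)
    qed
  qed (use rc M g c in \<open>auto simp: image_subset_iff\<close>)
qed

text \<open>Without a row, two classes of equal columns may merge and exceed \<open>s\<close>. Fewer
  than \<open>B\<close> merged classes do so, and removing from each the at most \<open>s\<close>
  columns with a 1 in the deleted row repairs them. Each row thus costs at most \<open>B * s\<close>
  columns; with no rows left, all columns are equal.\<close>

lemma card_columns_le:
  fixes a :: "'r \<Rightarrow> 'c \<Rightarrow> bool"
  assumes BB: "\<And>(R :: 'r set) (K :: 'c set). finite K \<Longrightarrow> inj_on (\<lambda>j. {i \<in> R. a i j}) K \<Longrightarrow> B \<le> card K \<Longrightarrow>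
      \<exists>M\<in>\<M>. occurs 1 k M a R K"
    and "finite R" "finite J"
    and "\<And>M. M \<in> \<M> \<Longrightarrow> \<not> occurs (Suc s) k M a R J"
    and "\<And>x. x \<in> J \<Longrightarrow> card {j \<in> J. \<forall>i\<in>R. a i j = a i x} \<le> s"
  shows "card J \<le> s + card R * (B * s)"
  using assms(2-)
proof (induction R arbitrary: J rule: finite_induct)
  case empty
  then show ?case by (cases "J = {}") auto
next
  case (insert \<rho> R)
  let ?key = "\<lambda>j. {i \<in> R. a i j}"
  \<comment> \<open>\<open>cls x\<close> is the class of \<open>x\<close> once row
    \<open>\<rho>\<close> is gone, \<open>bad\<close> the union of the classes that became too
    large, \<open>del\<close> the columns to discard.\<close>
  define cls where "cls = (\<lambda>x. {j \<in> J. \<forall>i\<in>R. a i j = a i x})"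
  define bad where "bad = {x \<in> J. s < card (cls x)}"
  define del where "del = {x \<in> bad. a \<rho> x}"
  have fin: "finite bad" "finite del" "\<And>x. finite (cls x)"
    using insert.prems(1) by (auto simp: bad_def del_def cls_def)
  \<comment> \<open>\<open>K\<close> holds one representative of each oversized class.\<close>
  obtain K where K: "K \<subseteq> bad" "inj_on ?key K" "?key ` K = ?key ` bad"
    using subset_image_inj[of "?key ` bad" ?key bad] by auto
  \<comment> \<open>Otherwise some pattern occurs in \<open>K\<close>, and the \<open>Suc s\<close>
    or more columns in each class multiply it to a forbidden one.\<close>
  have "card K < B"
  proof (rule ccontr)
    assume "\<not> card K < B"
    then obtain M where "M \<in> \<M>" "occurs 1 k M a R K"
      using BB[of K R] K(1,2) fin(1) by (auto intro: finite_subset)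
    moreover have "K \<subseteq> J" using K(1) by (auto simp: bad_def)
    moreover have "finite {j \<in> J. \<forall>i\<in>R. a i j = a i x} \<and> Suc s \<le> card {j \<in> J. \<forall>i\<in>R. a i j = a i x}"
      if "x \<in> K" for x
      using K(1) that fin(3)[of x] by (auto simp: bad_def cls_def)
    ultimately have "occurs (Suc s) k M a R J"
      using occurs_copies[OF _ _ K(2)] by blast
    then show False
      using insert.prems(2)[OF \<open>M \<in> \<M>\<close>] occurs_mono by blast
  qed
  \<comment> \<open>Fixing the value in row \<open>\<rho>\<close> gives back a class for
    \<open>insert \<rho> R\<close>, or nothing.\<close>
  have part: "card {j \<in> cls x. a \<rho> j = \<beta>} \<le> s" for x \<beta>
  proof (cases "{j \<in> cls x. a \<rho> j = \<beta>} = {}")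
    case False
    then obtain y where y: "y \<in> cls x" "a \<rho> y = \<beta>" by auto
    then have "{j \<in> cls x. a \<rho> j = \<beta>} = {j \<in> J. \<forall>i\<in>insert \<rho> R. a i j = a i y}" "y \<in> J"
      by (auto simp: cls_def)
    then show ?thesis using insert.prems(3)[of y] by simp
  next
    case True
    then show ?thesis by (simp only: card.empty)
  qed
  have "del \<subseteq> (\<Union>x\<in>K. {j \<in> cls x. a \<rho> j = True})"
  proof
    fix j assume j: "j \<in> del"
    then have "?key j \<in> ?key ` K" using K(3) by (auto simp: del_def)
    then obtain x where "x \<in> K" "?key j = ?key x" by auto
    then show "j \<in> (\<Union>x\<in>K. {j \<in> cls x. a \<rho> j = True})"
      using j by (intro UN_I[of x]) (auto simp: del_def bad_def cls_def)
  qed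
  then have "card del \<le> card (\<Union>x\<in>K. {j \<in> cls x. a \<rho> j = True})"
    using fin K(1) by (intro card_mono) (auto intro: finite_subset)
  also have "\<dots> \<le> (\<Sum>x\<in>K. card {j \<in> cls x. a \<rho> j = True})"
    using fin K(1) by (intro card_UN_le) (auto intro: finite_subset)
  also have "\<dots> \<le> card K * s"
    using sum_bounded_above[of K "\<lambda>x. card {j \<in> cls x. a \<rho> j = True}" s] part[of _ True] by auto
  also have "\<dots> \<le> B * s" using \<open>card K < B\<close> by simp
  finally have del: "card del \<le> B * s" .
  have "card (J - del) \<le> s + card R * (B * s)"
  proof (rule insert.IH)
    show "finite (J - del)" using insert.prems(1) by simp
    show "\<not> occurs (Suc s) k M a R (J - del)" if "M \<in> \<M>" for M
      using insert.prems(2)[OF that] occurs_mono by blast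
    fix x assume x: "x \<in> J - del"
    let ?C = "{j \<in> J - del. \<forall>i\<in>R. a i j = a i x}"
    show "card ?C \<le> s"
    \<comment> \<open>An oversized class keeps only its columns with a 0 in row
      \<open>\<rho>\<close>; any other class was small already.\<close>
    proof (cases "x \<in> bad")
      case True
      have "cls j = cls x" if "j \<in> cls x" for j
        using that by (auto simp: cls_def)
      then have "?C \<subseteq> {j \<in> cls x. a \<rho> j = False}"
        using True by (auto simp: bad_def del_def cls_def)
      then have "card ?C \<le> card {j \<in> cls x. a \<rho> j = False}"
        using fin(3) by (intro card_mono) auto
      then show ?thesis using part[of x False] by linarith
    next
      case False
      have "card ?C \<le> card (cls x)"
        using fin(3) by (intro card_mono) (auto simp: cls_def)
      then show ?thesis using False x by (auto simp: bad_def)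
    qed
  qed
  moreover have "card J = card (J - del) + card del"
  proof -
    have "del \<subseteq> J" by (auto simp: del_def bad_def)
    then show ?thesis
      using card_Diff_subset[of del J] card_mono[of J del] fin(2) insert.prems(1) by auto
  qed
  ultimately show ?case using del insert.hyps by simp
qed

section \<open>Configurations\<close>

lemma bij_betw_pick:
  assumes "finite I"
  shows "bij_betw (pick I) {..<card I} I"
proof -
  have inj: "inj_on (pick I) {..<card I}"
  proof (rule linorder_inj_onI')
    fix i j assume "i \<in> {..<card I}" "j \<in> {..<card I}" "i < j"
    then show "pick I i \<noteq> pick I j" using pick_mono_le[of j I i] by auto
  qed
  moreover have "pick I ` {..<card I} \<subseteq> I" by (auto intro: pick_in_set_le)
  ultimately show ?thesis
    using assms by (simp add: bij_betw_def card_image card_subset_eq)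
qed

text \<open>\<open>p\<close> sends \<open>i\<close> to the preimage of the \<open>i\<close>-th
  smallest value of \<open>r\<close>. This sorting is needed because \<open>submatrix\<close> takes
  its indices in increasing order.\<close>

lemma inj_on_eq_pick_permutes:
  assumes "inj_on r {..<n}"
  obtains p where "p permutes {..<n}" "\<And>i. i < n \<Longrightarrow> r (p i) = pick (r ` {..<n}) i"
proof -
  \<comment> \<open>Outside \<open>{..<n}\<close> the map is the identity, as
    \<open>permutes\<close> demands.\<close>
  let ?p = "\<lambda>i. if i < n then the_inv_into {..<n} r (pick (r ` {..<n}) i) else i"
  have card: "card (r ` {..<n}) = n" using assms by (simp add: card_image)
  have pick: "bij_betw (pick (r ` {..<n})) {..<n} (r ` {..<n})"
    using bij_betw_pick[of "r ` {..<n}"] card by simp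
  have "bij_betw (the_inv_into {..<n} r) (r ` {..<n}) {..<n}"
    using assms by (intro bij_betw_the_inv_into) (simp add: bij_betw_def)
  from bij_betw_trans[OF pick this] have "bij_betw ?p {..<n} {..<n}"
    by (rule bij_betw_cong[THEN iffD1, rotated]) auto
  then have "?p permutes {..<n}" by (rule bij_imp_permutes) simp
  moreover have "r (?p i) = pick (r ` {..<n}) i" if "i < n" for i
    using that f_the_inv_into_f[OF assms] bij_betwE[OF pick] by auto
  ultimately show ?thesis by (rule that)
qed

text \<open>Permuting and then selecting in increasing order amounts to choosing arbitrary
  injections of the row and column indices. The later arguments can thus avoid \<open>pick\<close>
  and \<open>permutes\<close>.\<close>

lemma configuration_iff:
  "F \<prec>\<^sub>c A \<longleftrightarrow> (\<exists>r c. inj_on r {..<dim_row F} \<and> r ` {..<dim_row F} \<subseteq> {..<dim_row A} \<and>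
      inj_on c {..<dim_col F} \<and> c ` {..<dim_col F} \<subseteq> {..<dim_col A} \<and>
      (\<forall>i<dim_row F. \<forall>j<dim_col F. F $$ (i, j) = A $$ (r i, c j)))"
proof
  assume "F \<prec>\<^sub>c A"
  then obtain p q I J where pq: "p permutes {..<dim_row F}" "q permutes {..<dim_col F}"
    and IJ: "I \<subseteq> {..<dim_row A}" "J \<subseteq> {..<dim_col A}" and eq: "permute_mat p q F = submatrix A I J"
    unfolding configuration_def by blast
  have sets: "{i. i < dim_row A \<and> i \<in> I} = I" "{j. j < dim_col A \<and> j \<in> J} = J"
    using IJ by auto
  have dims: "dim_row F = card I" "dim_col F = card J"
    using arg_cong[OF eq, of dim_row] arg_cong[OF eq, of dim_col]
    by (simp_all add: permute_mat_def dim_submatrix sets)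
  \<comment> \<open>\<open>permute_mat\<close> moves entry \<open>(p i, q j)\<close> to
    \<open>(i, j)\<close>, so locating an entry of \<open>F\<close> takes the inverse
    permutations.\<close>
  have bij: "bij_betw (pick I \<circ> inv_into UNIV p) {..<dim_row F} I" "bij_betw (pick J \<circ> inv_into UNIV q) {..<dim_col F} J"
    using bij_betw_trans[OF permutes_imp_bij[OF permutes_inv[OF pq(1)]]]
      bij_betw_trans[OF permutes_imp_bij[OF permutes_inv[OF pq(2)]]]
      bij_betw_pick[OF finite_subset[OF IJ(1)]] bij_betw_pick[OF finite_subset[OF IJ(2)]]
    by (simp_all add: dims)
  have "F $$ (i, j) = A $$ (pick I (inv_into UNIV p i), pick J (inv_into UNIV q j))"
    if "i < dim_row F" "j < dim_col F" for i j
  proof -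
    have lt: "inv_into UNIV p i < dim_row F" "inv_into UNIV q j < dim_col F"
      using that permutes_in_image[OF permutes_inv[OF pq(1)], of i]
        permutes_in_image[OF permutes_inv[OF pq(2)], of j] by auto
    have "F $$ (i, j) = permute_mat p q F $$ (inv_into UNIV p i, inv_into UNIV q j)"
      using lt permutes_inverses[OF pq(1)] permutes_inverses[OF pq(2)]
      by (simp add: permute_mat_def)
    also have "\<dots> = A $$ (pick I (inv_into UNIV p i), pick J (inv_into UNIV q j))"
      unfolding eq using lt by (intro submatrix_index) (simp_all add: sets dims)
    finally show ?thesis .
  qed
  then show "\<exists>r c. inj_on r {..<dim_row F} \<and> r ` {..<dim_row F} \<subseteq> {..<dim_row A} \<and>
      inj_on c {..<dim_col F} \<and> c ` {..<dim_col F} \<subseteq> {..<dim_col A} \<and>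
      (\<forall>i<dim_row F. \<forall>j<dim_col F. F $$ (i, j) = A $$ (r i, c j))"
    using bij IJ
    by (intro exI[of _ "pick I \<circ> inv_into UNIV p"] exI[of _ "pick J \<circ> inv_into UNIV q"]) (auto simp: bij_betw_def)
next
  assume "\<exists>r c. inj_on r {..<dim_row F} \<and> r ` {..<dim_row F} \<subseteq> {..<dim_row A} \<and>
      inj_on c {..<dim_col F} \<and> c ` {..<dim_col F} \<subseteq> {..<dim_col A} \<and>
      (\<forall>i<dim_row F. \<forall>j<dim_col F. F $$ (i, j) = A $$ (r i, c j))"
  then obtain r c where r: "inj_on r {..<dim_row F}" "r ` {..<dim_row F} \<subseteq> {..<dim_row A}"
    and c: "inj_on c {..<dim_col F}" "c ` {..<dim_col F} \<subseteq> {..<dim_col A}"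
    and eq: "\<forall>i<dim_row F. \<forall>j<dim_col F. F $$ (i, j) = A $$ (r i, c j)" by blast
  obtain p where p: "p permutes {..<dim_row F}"
    "\<And>i. i < dim_row F \<Longrightarrow> r (p i) = pick (r ` {..<dim_row F}) i"
    using inj_on_eq_pick_permutes[OF r(1)] by blast
  obtain q where q: "q permutes {..<dim_col F}"
    "\<And>j. j < dim_col F \<Longrightarrow> c (q j) = pick (c ` {..<dim_col F}) j"
    using inj_on_eq_pick_permutes[OF c(1)] by blast
  have sets: "{i. i < dim_row A \<and> i \<in> r ` {..<dim_row F}} = r ` {..<dim_row F}"
    "{j. j < dim_col A \<and> j \<in> c ` {..<dim_col F}} = c ` {..<dim_col F}"
    using r(2) c(2) by auto
  have "permute_mat p q F = submatrix A (r ` {..<dim_row F}) (c ` {..<dim_col F})"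
  proof (rule eq_matI)
    fix i j
    assume "i < dim_row (submatrix A (r ` {..<dim_row F}) (c ` {..<dim_col F}))"
      and "j < dim_col (submatrix A (r ` {..<dim_row F}) (c ` {..<dim_col F}))"
    then have ij: "i < dim_row F" "j < dim_col F"
      by (simp_all add: dim_submatrix sets card_image r c)
    then have "p i < dim_row F" "q j < dim_col F"
      using permutes_in_image[OF p(1), of i] permutes_in_image[OF q(1), of j] by auto
    then show "permute_mat p q F $$ (i, j) = submatrix A (r ` {..<dim_row F}) (c ` {..<dim_col F}) $$ (i, j)"
      using ij p(2) q(2) eq by (subst submatrix_index) (simp_all add: permute_mat_def sets card_image r c)
  qed (simp_all add: permute_mat_def dim_submatrix sets card_image r c)
  then show "F \<prec>\<^sub>c A"
    unfolding configuration_def using p(1) q(1) r(2) c(2) by blast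
qed

text \<open>A (0,1)-entry is determined by whether it equals 1, so the Boolean pattern fixes the
  integer entries.\<close>

lemma occurs_imp_configuration:
  assumes A: "zero_one_mat A"
    and occ: "occurs t k M (\<lambda>i j. A $$ (i, j) = 1) {..<dim_row A} {..<dim_col A}"
    and F: "dim_row F = k" "dim_col F = k"
      "\<And>i j. i < k \<Longrightarrow> j < k \<Longrightarrow> F $$ (i, j) = (if M i j then 1 else 0)"
  shows "copies t F \<prec>\<^sub>c A"
proof -
  obtain r c where rc: "inj_on r {..<k}" "r ` {..<k} \<subseteq> {..<dim_row A}"
    "inj_on c {..<t * k}" "c ` {..<t * k} \<subseteq> {..<dim_col A}"
    and M: "\<forall>i<k. \<forall>j<t * k. (A $$ (r i, c j) = 1) \<longleftrightarrow> M i (j mod k)"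
    using occ unfolding occurs_def by blast
  have "copies t F $$ (i, j) = A $$ (r i, c j)" if ij: "i < k" "j < t * k" for i j
  proof -
    have "r i < dim_row A" "c j < dim_col A" using rc ij by auto
    then have "A $$ (r i, c j) \<in> {0, 1}"
      using A unfolding zero_one_mat_def by (blast intro: elements_matI)
    moreover have "copies t F $$ (i, j) = (if M i (j mod k) then 1 else 0)"
      using ij F by (simp add: copies_def)
    ultimately show ?thesis using M ij by auto
  qed
  then show ?thesis
    unfolding configuration_iff using rc F by (auto simp: copies_def)
qed

section \<open>The lower bound from identity matrices\<close>

lemma one_mat_avoids:
  assumes "i < dim_row F" "j < dim_col F" "j' < dim_col F" "j \<noteq> j'" "F $$ (i, j) = 1" "F $$ (i, j') = 1"
  shows "\<not> F \<prec>\<^sub>c 1\<^sub>m m"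
proof
  assume "F \<prec>\<^sub>c 1\<^sub>m m"
  then obtain r c where "r ` {..<dim_row F} \<subseteq> {..<m}" "inj_on c {..<dim_col F}" "c ` {..<dim_col F} \<subseteq> {..<m}"
    and eq: "\<forall>i<dim_row F. \<forall>j<dim_col F. F $$ (i, j) = 1\<^sub>m m $$ (r i, c j)"
    unfolding configuration_iff by auto
  then have "r i < m" "c j < m" "c j' < m" "c j \<noteq> c j'"
    using assms by (auto dest: inj_onD)
  moreover have "1\<^sub>m m $$ (r i, c j) = (1::int)" "1\<^sub>m m $$ (r i, c j') = (1::int)"
    using eq assms by auto
  ultimately show False by (auto split: if_splits)
qed

lemma one_mat_avoids_copies:
  assumes "2 \<le> t" "dim_row F = k" "dim_col F = k" "i < k" "j < k" "F $$ (i, j) = 1"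
  shows "\<not> copies t F \<prec>\<^sub>c 1\<^sub>m m"
\<comment> \<open>Columns \<open>j\<close> and \<open>k + j\<close> are the same column of
  \<open>F\<close> in its first two copies.\<close>
proof (rule one_mat_avoids[of i _ j "k + j"])
  have "2 * k \<le> t * k" using assms(1) by simp
  then have "k + j < t * k" using assms(5) by linarith
  then show "j < dim_col (copies t F)" "k + j < dim_col (copies t F)"
    using assms(3) by (simp_all add: copies_def)
  then show "copies t F $$ (i, j) = 1" "copies t F $$ (i, k + j) = 1"
    using assms by (simp_all add: copies_def)
qed (use assms in \<open>simp_all add: copies_def\<close>)

lemma simple_one_mat: "simple_mat (1\<^sub>m m)"
proof -
  have "inj_on (col (1\<^sub>m m :: int mat)) {..<m}"
  proof (rule inj_onI)
    fix i j assume "i \<in> {..<m}" "j \<in> {..<m}" "col (1\<^sub>m m :: int mat) i = col (1\<^sub>m m) j"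
    then have "col (1\<^sub>m m :: int mat) i $ i = col (1\<^sub>m m) j $ i" "i < m" "j < m" by auto
    then show "i = j" by (simp split: if_splits)
  qed
  then have "distinct (cols (1\<^sub>m m :: int mat))"
    by (simp add: cols_def distinct_map atLeast0LessThan)
  then show ?thesis
    by (auto simp: simple_mat_def zero_one_mat_def elements_mat_def)
qed

section \<open>The upper bound for simple matrices\<close>

lemma simple_mat_card_columns_eq_le:
  assumes "simple_mat A" "x < dim_col A"
  shows "card {j \<in> {..<dim_col A}. \<forall>i\<in>{..<dim_row A}. (A $$ (i, j) = 1) = (A $$ (i, x) = 1)} \<le> 1"
proof -
  have "j = x" if j: "j < dim_col A" "\<forall>i\<in>{..<dim_row A}. (A $$ (i, j) = 1) = (A $$ (i, x) = 1)" for j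
  proof -
    have "A $$ (i, j) = A $$ (i, x)" if "i < dim_row A" for i
    proof -
      have "A $$ (i, j) \<in> {0, 1}" "A $$ (i, x) \<in> {0, 1}"
        using assms that j(1) unfolding simple_mat_def zero_one_mat_def by (blast intro: elements_matI)+
      then show ?thesis using bspec[OF j(2), of i] that by auto
    qed
    then have "cols A ! j = cols A ! x" using assms(2) j(1) by (auto intro!: eq_vecI)
    then show ?thesis
      using assms j(1) by (simp add: simple_mat_def nth_eq_iff_index_eq del: cols_nth)
  qed
  then have "{j \<in> {..<dim_col A}. \<forall>i\<in>{..<dim_row A}. (A $$ (i, j) = 1) = (A $$ (i, x) = 1)} \<subseteq> {x}"
    by auto
  then show ?thesis using card_mono[of "{x}"] by simp
qed

lemma dim_col_avoiding_le:
  assumes "t \<ge> 2"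
  shows "\<exists>C. \<forall>A. simple_mat A \<longrightarrow>
    (\<forall>F\<in>{copies t (1\<^sub>m k), copies t (compl_mat (1\<^sub>m k)), copies t (tower_mat k)}. \<not> F \<prec>\<^sub>c A) \<longrightarrow>
    dim_col A \<le> C + dim_row A * C"
proof -
  let ?\<M> = "{(=), (\<noteq>), (\<le>)} :: (nat \<Rightarrow> nat \<Rightarrow> bool) set"
  obtain B where B: "\<And>(a :: nat \<Rightarrow> nat \<Rightarrow> bool) R J. finite J \<Longrightarrow> inj_on (\<lambda>j. {i \<in> R. a i j}) J \<Longrightarrow>
      B \<le> card J \<Longrightarrow> \<exists>M\<in>?\<M>. occurs 1 k M a R J"
    using Balogh_Bollobas[where 'r = nat and 'c = nat, of k] by blast
  \<comment> \<open>The largest multiplicity allowed; it is at least 1, so simple matrices satisfy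
    the bound.\<close>
  define s where "s = t - 1"
  have s: "Suc s = t" "1 \<le> s" using assms by (auto simp: s_def)
  \<comment> \<open>\<open>s + B * s\<close> dominates both the initial term \<open>s\<close> and
    the cost \<open>B * s\<close> per row.\<close>
  have "dim_col A \<le> (s + B * s) + dim_row A * (s + B * s)"
    if A: "simple_mat A"
      "\<forall>F\<in>{copies t (1\<^sub>m k), copies t (compl_mat (1\<^sub>m k)), copies t (tower_mat k)}. \<not> F \<prec>\<^sub>c A" for A
  proof -
    let ?a = "\<lambda>i j. A $$ (i, j) = 1"
    have zo: "zero_one_mat A" using A(1) by (simp add: simple_mat_def)
    have "\<not> occurs t k (=) ?a {..<dim_row A} {..<dim_col A}"
      using occurs_imp_configuration[OF zo, of t k "(=)" "1\<^sub>m k"] A(2) by auto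
    moreover have "\<not> occurs t k (\<noteq>) ?a {..<dim_row A} {..<dim_col A}"
      using occurs_imp_configuration[OF zo, of t k "(\<noteq>)" "compl_mat (1\<^sub>m k)"] A(2)
      by (force simp: compl_mat_def)
    moreover have "\<not> occurs t k (\<le>) ?a {..<dim_row A} {..<dim_col A}"
      using occurs_imp_configuration[OF zo, of t k "(\<le>)" "tower_mat k"] A(2)
      by (auto simp: tower_mat_def)
    ultimately have avoid: "\<not> occurs (Suc s) k M ?a {..<dim_row A} {..<dim_col A}" if "M \<in> ?\<M>" for M
      using that s by auto
    have mult: "card {j \<in> {..<dim_col A}. \<forall>i\<in>{..<dim_row A}. ?a i j = ?a i x} \<le> s"
      if "x \<in> {..<dim_col A}" for x
      using simple_mat_card_columns_eq_le[OF A(1), of x] that s(2) by auto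
    have "card {..<dim_col A} \<le> s + card {..<dim_row A} * (B * s)"
      by (rule card_columns_le[OF B _ _ avoid mult]) simp_all
    then show ?thesis by (simp add: algebra_simps)
  qed
  then show ?thesis by (intro exI[of _ "s + B * s"] allI impI)
qed

section \<open>From explicit bounds to the order of growth\<close>

theorem theorem8:
  fixes t k :: nat
  assumes "t \<ge> 2" and "k \<ge> 2"
  shows "(\<lambda>m. real (forb m {copies t (1\<^sub>m k), copies t (compl_mat (1\<^sub>m k)), copies t (tower_mat k)}))
           \<in> \<Theta>(\<lambda>m. real m)"
proof -
  let ?F = "{copies t (1\<^sub>m k), copies t (compl_mat (1\<^sub>m k)), copies t (tower_mat k)}"
  define S where "S = (\<lambda>m. {dim_col A | A. dim_row A = m \<and> simple_mat A \<and> (\<forall>F\<in>?F. \<not> F \<prec>\<^sub>c A)})"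
  have forb: "forb m ?F = Max (S m)" for m by (simp add: forb_def S_def)
  obtain C where C: "\<And>m n. n \<in> S m \<Longrightarrow> n \<le> C + m * C"
    using dim_col_avoiding_le[OF assms(1), of k] by (auto simp: S_def)
  \<comment> \<open>Finiteness here and the member \<open>m\<close> found below give
    \<open>Max\<close> its meaning.\<close>
  have fin: "finite (S m)" for m
    using C[of _ m] by (intro finite_subset[of "S m" "{..C + m * C}"]) auto
  have "\<not> copies t (1\<^sub>m k) \<prec>\<^sub>c 1\<^sub>m m" for m
    using assms by (intro one_mat_avoids_copies[where i = 0 and j = 0 and k = k]) auto
  \<comment> \<open>The complement has its 1s off the diagonal, hence column 1, available as
    \<open>k\<close> is at least 2.\<close>
  moreover have "\<not> copies t (compl_mat (1\<^sub>m k)) \<prec>\<^sub>c 1\<^sub>m m" for m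
    using assms by (intro one_mat_avoids_copies[where i = 0 and j = 1 and k = k]) (auto simp: compl_mat_def)
  moreover have "\<not> copies t (tower_mat k) \<prec>\<^sub>c 1\<^sub>m m" for m
    using assms by (intro one_mat_avoids_copies[where i = 0 and j = 0 and k = k]) (auto simp: tower_mat_def)
  ultimately have mem: "m \<in> S m" for m
    using simple_one_mat[of m] by (auto simp: S_def intro!: exI[of _ "1\<^sub>m m"])
  have lower: "m \<le> forb m ?F" for m
    unfolding forb using fin mem by (rule Max_ge)
  have upper: "forb m ?F \<le> C + m * C" for m
    unfolding forb using fin mem C by (metis Max_in empty_iff)
  show ?thesis
  proof (rule bigthetaI)
    \<comment> \<open>For positive \<open>m\<close> the additive constant \<open>C\<close> is
      absorbed into \<open>m * C\<close>.\<close>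
    have "real (forb m ?F) \<le> real (2 * C) * real m" if "1 \<le> m" for m
    proof -
      have "C \<le> m * C" using that by simp
      then have "forb m ?F \<le> 2 * (m * C)" using upper[of m] by linarith
      then have "forb m ?F \<le> 2 * C * m" by (simp only: mult_ac)
      then have "real (forb m ?F) \<le> real (2 * C * m)" by (rule of_nat_mono)
      then show ?thesis by simp
    qed
    then show "(\<lambda>m. real (forb m ?F)) \<in> O(\<lambda>m. real m)"
      by (intro bigoI[of _ "real (2 * C)"] eventually_at_top_linorderI[of 1]) simp_all
    show "(\<lambda>m. real (forb m ?F)) \<in> \<Omega>(\<lambda>m. real m)"
      by (rule landau_omega.bigI[of 1]) (simp_all add: lower)
  qed
qed

end
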